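(* Let $k$ be a positive integer with $k \equiv 2 \pmod{15}$ and let \[ n = L_{CC}(10,k) = \frac{512k^5+1280k^4+6080k^3+7840k^2+10010k+3741}{3125}. \] Then there is an undirected Cayley graph of the cyclic group $\mathbb{Z}_n$ on five generators which has diameter $k$. Moreover, a generating set for such a graph is \[ \Big\{1,\ \tfrac{128k^4+256k^3+1192k^2+1064k+883}{625},\ \tfrac{512k^5+640k^4+4000k^3-1320k^2-6660k-11899}{9375},\ \tfrac{512k^5+640k^4+4000k^3-1320k^2+840k-8149}{9375},\ \tfrac{512k^5+640k^4+6400k^3+2280k^2+13890k-2224}{9375}\Big\}, \] i.e. the Cayley graph of $\mathbb{Z}_n$ with connection set $\{\pm g_1,\dots,\pm g_5\}$, where $g_1,\dots,g_5$ are these integers taken modulo $n$, has diameter $k$.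
   Context: For a positive integer $n$ and integers $g_1,\dots,g_5$, the undirected Cayley (circulant) graph of the cyclic group $\mathbb{Z}_n$ with generating set $\{g_1,\dots,g_5\}$ has vertex set $\mathbb{Z}_n$, with $i$ and $j$ adjacent if and only if $j-i \equiv \pm g_t \pmod n$ for some $t$. Its diameter is the maximum over pairs of vertices of the graph distance. The notation $L_{CC}(10,k)$ is just a name for the displayed polynomial value. *)

theory Defs
  imports
    Complex_Main
    "HOL-Library.Extended_Nat"
    "HOL-Number_Theory.Cong"
    "Graph_Theory.Graph_Theory"
begin

text \<open>
  The undirected Cayley graph of the cyclic group of order \<open>n > 0\<close>. The group is represented by
  the residues \<open>{0..<n}\<close>; each edge is a pair of opposite arcs. The elements of \<open>S\<close> may be
  arbitrary integers and matter only modulo \<open>n\<close>.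
\<close>

definition circulant_graph :: "nat \<Rightarrow> int set \<Rightarrow> int pair_pre_digraph" where
  "circulant_graph n S =
     \<lparr> pverts = {0..<int n},
       parcs = {(i, j). i \<in> {0..<int n} \<and> j \<in> {0..<int n} \<and>
                  (\<exists>g\<in>S. [j - i = g] (mod int n) \<or> [j - i = - g] (mod int n))} \<rparr>"

text \<open>The distance is \<open>\<infinity>\<close> when no walk exists, so a graph with finite diameter is connected.\<close>

definition graph_dist :: "('a, 'b) pre_digraph \<Rightarrow> 'a \<Rightarrow> 'a \<Rightarrow> enat" where
  "graph_dist G u v = (INF p \<in> {p. pre_digraph.awalk G u p v}. enat (length p))"

definition graph_diameter :: "('a, 'b) pre_digraph \<Rightarrow> enat" where
  "graph_diameter G = (SUP u \<in> verts G. SUP v \<in> verts G. graph_dist G u v)"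

lemma pair_wf_digraph_circulant_graph: "pair_wf_digraph (circulant_graph n S)"
  by unfold_locales (auto simp: circulant_graph_def)

lemma symmetric_circulant_graph: "symmetric (with_proj (circulant_graph n S))"
proof -
  have flip: "[i - j = - g] (mod m)" if "[j - i = g] (mod m)" for i j g m :: int
    using cong_minus_minus_iff[THEN iffD2, OF that] by simp
  have "(j, i) \<in> parcs (circulant_graph n S)" if "(i, j) \<in> parcs (circulant_graph n S)" for i j
    using that flip[of j i _ "int n"] flip[of j i "- g" "int n" for g]
    unfolding circulant_graph_def by fastforce
  then have "sym (parcs (circulant_graph n S))"
    by (rule symI)
  then show ?thesis
    by (simp add: symmetric_def)
qed

end

theory Submission
  imports Defs
begin

text \<open>
  Write \<open>k = 15 m + 2\<close> and \<open>a = 6 m + 1\<close>, so that \<open>2 k + 1 = 5 a\<close>. Let \<open>L\<close> be the lattice of all \<open>x\<close> in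
  \<open>\<int>\<^sup>5\<close> with \<open>\<Sum>i. g\<^sub>i x\<^sub>i\<close> divisible by \<open>n\<close>; the distance of a vertex from \<open>0\<close> is the least \<open>l\<^sub>1\<close>-norm
  in the corresponding coset of \<open>L\<close>. The lattice is generated by five vectors
  \<open>u\<^sub>i = 2 a e\<^sub>i + A\<^sub>i\<close>, where \<open>A\<close> is an antisymmetric matrix with entries in \<open>{-1, 0, 1}\<close>, together with
  \<open>v = (u\<^sub>1 + \<dots> + u\<^sub>5) / 2\<close>. By antisymmetry every vector \<open>v\<^sub>s = (s\<^sub>1 u\<^sub>1 + \<dots> + s\<^sub>5 u\<^sub>5) / 2\<close> with signs
  \<open>s\<^sub>i\<close> has \<open>l\<^sub>1\<close>-norm exactly \<open>5 a\<close>.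

  Upper bound: if \<open>x\<close> lies in the box spanned by \<open>0\<close> and \<open>v\<^sub>s\<close>, then the norms of \<open>x\<close> and \<open>x - v\<^sub>s\<close> add up
  to \<open>2 k + 1\<close>, so one of them is at most \<open>k\<close>. These boxes cover \<open>\<int>\<^sup>5\<close> modulo \<open>L\<close>. Indeed, once \<open>x\<close> is reduced
  to about \<open>[-a/2, 3a/2]\<close> in each coordinate, each coordinate only has to choose one side of its nearest box
  face, at \<open>0\<close> or at \<open>a\<close>. The exact position of the face in coordinate \<open>i\<close> depends on the choice in
  coordinate \<open>j\<close> only if \<open>A\<^sub>i\<^sub>j \<noteq> 0\<close> and the two faces are of different kinds. The support of \<open>A\<close> consists of
  the triangles 1-3-4 and 2-5-4, so these dependencies form a forest, and consistent choices are made
  from the leaves inwards, ending with coordinate 4.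

  Lower bound: a point next to the centre \<open>v / 2\<close> of a box has distance at least \<open>k\<close> from \<open>0\<close> and \<open>v\<close>, and all
  other lattice points are farther away. Both arguments need \<open>a \<ge> 7\<close>; the case \<open>k = 2\<close>, \<open>n = 45\<close> is checked directly.
\<close>

subsection \<open>Diameter of circulant graphs\<close>

lemma circulant_awalk_ConsI:
  fixes n :: nat
  assumes "n > 0" "u \<in> {0..<int n}" "h \<in> S \<or> - h \<in> S"
    and "pre_digraph.awalk (with_proj (circulant_graph n S)) ((u + h) mod int n) p v"
  shows "pre_digraph.awalk (with_proj (circulant_graph n S)) u ((u, (u + h) mod int n) # p) v"
proof -
  have c: "[(u + h) mod int n - u = h] (mod int n)"
    by (metis add_diff_cancel_left' cong_def mod_diff_left_eq)
  have "(u, (u + h) mod int n) \<in> parcs (circulant_graph n S)"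
    using assms(1,2,3) c bexI[of _ h S] bexI[of _ "- h" S] unfolding circulant_graph_def by auto
  then show ?thesis
    using assms by (auto simp: pre_digraph.awalk_def pre_digraph.cas.simps circulant_graph_def)
qed

lemma circulant_awalk_of_word:
  assumes "n > 0" "u \<in> {0..<int n}" "\<forall>h\<in>set hs. h \<in> S \<or> - h \<in> S"
  shows "\<exists>p. length p = length hs \<and>
    pre_digraph.awalk (with_proj (circulant_graph n S)) u p ((u + sum_list hs) mod int n)"
  using assms(2,3)
proof (induction hs arbitrary: u)
  case Nil
  then show ?case
    by (auto simp: pre_digraph.awalk_def pre_digraph.cas.simps circulant_graph_def)
next
  case (Cons h hs)
  let ?w = "(u + h) mod int n"
  have "?w \<in> {0..<int n}" using \<open>n > 0\<close> by simp
  then obtain p where p: "length p = length hs"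
    "pre_digraph.awalk (with_proj (circulant_graph n S)) ?w p ((?w + sum_list hs) mod int n)"
    using Cons.IH[of ?w] Cons.prems by auto
  have e: "(?w + sum_list hs) mod int n = (u + sum_list (h # hs)) mod int n"
    by (simp add: mod_simps add.assoc)
  have "pre_digraph.awalk (with_proj (circulant_graph n S)) u ((u, ?w) # p)
      ((u + sum_list (h # hs)) mod int n)"
    using circulant_awalk_ConsI[OF \<open>n > 0\<close> Cons.prems(1), of h S] Cons.prems(2) p(2)
    by (auto simp: e)
  then show ?case using p(1) by (intro exI[of _ "(u, ?w) # p"]) simp
qed

lemma word_of_circulant_awalk:
  assumes "pre_digraph.awalk (with_proj (circulant_graph n S)) u p v"
  shows "\<exists>hs. length hs = length p \<and> (\<forall>h\<in>set hs. h \<in> S \<or> - h \<in> S) \<and>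
    [v - u = sum_list hs] (mod int n)"
  using assms
proof (induction p arbitrary: u)
  case Nil
  then show ?case by (auto simp: pre_digraph.awalk_def pre_digraph.cas.simps)
next
  case (Cons e p)
  obtain i j where e: "e = (i, j)" by (cases e)
  have ij: "i = u" "(i, j) \<in> parcs (circulant_graph n S)"
    and tl: "pre_digraph.awalk (with_proj (circulant_graph n S)) j p v"
    using Cons.prems by (auto simp: e pre_digraph.awalk_def pre_digraph.cas.simps circulant_graph_def)
  obtain h where h: "h \<in> S \<or> - h \<in> S" "[j - u = h] (mod int n)"
  proof -
    from ij obtain g where g: "g \<in> S" "[j - u = g] (mod int n) \<or> [j - u = - g] (mod int n)"
      unfolding circulant_graph_def by auto
    then show thesis using that[of g] that[of "-g"] by auto
  qed
  obtain hs where hs: "length hs = length p" "\<forall>h\<in>set hs. h \<in> S \<or> - h \<in> S"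
    "[v - j = sum_list hs] (mod int n)"
    using Cons.IH[OF tl] by auto
  have "[(j - u) + (v - j) = h + sum_list hs] (mod int n)"
    using h(2) hs(3) by (rule cong_add)
  then have "[v - u = sum_list (h # hs)] (mod int n)" by simp
  then show ?case using h(1) hs(1,2) by (intro exI[of _ "h # hs"]) auto
qed

text \<open>Translations are automorphisms: a walk from \<open>u\<close> to \<open>v\<close> is a
  word in the signed generators with sum \<open>v - u\<close> modulo \<open>n\<close>. Hence one far
  residue \<open>r0\<close>, seen from vertex 0, gives the lower bound.\<close>

lemma graph_diameter_circulant_eqI:
  fixes n k :: nat
  assumes "n > 0"
    and upper: "\<And>r. \<exists>hs. length hs \<le> k \<and> (\<forall>h\<in>set hs. h \<in> S \<or> - h \<in> S) \<and>
      [sum_list hs = r] (mod int n)"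
    and lower: "\<And>hs. (\<forall>h\<in>set hs. h \<in> S \<or> - h \<in> S) \<Longrightarrow> [sum_list hs = r0] (mod int n) \<Longrightarrow>
      k \<le> length hs"
  shows "graph_diameter (with_proj (circulant_graph n S)) = enat k"
proof (rule antisym)
  let ?G = "with_proj (circulant_graph n S)"
  have vs: "verts ?G = {0..<int n}" by (simp add: circulant_graph_def)
  show "graph_diameter ?G \<le> enat k"
    unfolding graph_diameter_def vs
  proof (intro SUP_least)
    fix u v assume uv: "u \<in> {0..<int n}" "v \<in> {0..<int n}"
    obtain hs where hs: "length hs \<le> k" "\<forall>h\<in>set hs. h \<in> S \<or> - h \<in> S"
      "[sum_list hs = v - u] (mod int n)" using upper by blast
    obtain p where p: "length p = length hs"
      "pre_digraph.awalk ?G u p ((u + sum_list hs) mod int n)"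
      using circulant_awalk_of_word[OF \<open>n > 0\<close> uv(1) hs(2)] by blast
    have "[u + sum_list hs = u + (v - u)] (mod int n)"
      using hs(3) by (intro cong_add) auto
    then have "(u + sum_list hs) mod int n = v" using uv(2) by (simp add: cong_def)
    then have "graph_dist ?G u v \<le> enat (length p)"
      using p(2) unfolding graph_dist_def by (intro INF_lower) simp
    also have "\<dots> \<le> enat k" using p(1) hs(1) by simp
    finally show "graph_dist ?G u v \<le> enat k" .
  qed
  have "enat k \<le> graph_dist ?G 0 (r0 mod int n)"
    unfolding graph_dist_def
  proof (intro INF_greatest)
    fix p assume "p \<in> {p. pre_digraph.awalk ?G 0 p (r0 mod int n)}"
    then obtain hs where "length hs = length p" "\<forall>h\<in>set hs. h \<in> S \<or> - h \<in> S"
      "[r0 mod int n - 0 = sum_list hs] (mod int n)"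
      using word_of_circulant_awalk by blast
    then show "enat k \<le> enat (length p)"
      using lower[of hs] by (simp add: cong_def)
  qed
  also have "\<dots> \<le> (SUP v \<in> verts ?G. graph_dist ?G 0 v)"
    using \<open>n > 0\<close> by (intro SUP_upper) (simp add: circulant_graph_def)
  also have "\<dots> \<le> graph_diameter ?G"
    unfolding graph_diameter_def using \<open>n > 0\<close> by (intro SUP_upper) (simp add: circulant_graph_def)
  finally show "enat k \<le> graph_diameter ?G" .
qed

lemma circulant_graph_mod: "circulant_graph n ((\<lambda>g. g mod int n) ` S) = circulant_graph n S"
proof -
  have "[d = g mod int n] (mod int n) \<longleftrightarrow> [d = g] (mod int n)"
    "[d = - (g mod int n)] (mod int n) \<longleftrightarrow> [d = - g] (mod int n)" for d g
    by (simp_all add: cong_def mod_minus_eq)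
  then show ?thesis unfolding circulant_graph_def by simp
qed

lemma word_of_vector:
  fixes x1 :: int
  shows "\<exists>hs. int (length hs) = \<bar>x1\<bar> + \<bar>x2\<bar> + \<bar>x3\<bar> + \<bar>x4\<bar> + \<bar>x5\<bar> \<and>
    (\<forall>h\<in>set hs. h \<in> {g1, g2, g3, g4, g5} \<or> - h \<in> {g1, g2, g3, g4, g5}) \<and>
    sum_list hs = g1 * x1 + g2 * x2 + g3 * x3 + g4 * x4 + g5 * x5"
proof -
  define r where "r x g = replicate (nat \<bar>x\<bar>) (sgn x * g)" for x g :: int
  have l: "int (length (r x g)) = \<bar>x\<bar>" for x g by (simp add: r_def)
  have s: "sum_list (r x g) = g * x" for x g
    by (simp add: r_def sum_list_replicate abs_sgn_eq mult.assoc[symmetric] abs_mult_sgn)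
  have m: "h = g \<or> - h = g" if "h \<in> set (r x g)" for h x g
    using that by (auto simp: r_def sgn_if split: if_splits)
  show ?thesis
    by (rule exI[of _ "r x1 g1 @ r x2 g2 @ r x3 g3 @ r x4 g4 @ r x5 g5"])
      (auto simp: l s dest!: m)
qed

text \<open>Only an inequality, since opposite letters of a word cancel in the vector.\<close>

lemma vector_of_word:
  fixes g1 :: int
  assumes "\<forall>h\<in>set hs. h \<in> {g1, g2, g3, g4, g5} \<or> - h \<in> {g1, g2, g3, g4, g5}"
  shows "\<exists>x1 x2 x3 x4 x5. \<bar>x1\<bar> + \<bar>x2\<bar> + \<bar>x3\<bar> + \<bar>x4\<bar> + \<bar>x5\<bar> \<le> int (length hs) \<and>
    sum_list hs = g1 * x1 + g2 * x2 + g3 * x3 + g4 * x4 + g5 * x5"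
  using assms
proof (induction hs)
  case Nil
  then show ?case by (intro exI[of _ 0]) simp
next
  case (Cons h hs)
  then obtain x1 x2 x3 x4 x5 where
    x: "\<bar>x1\<bar> + \<bar>x2\<bar> + \<bar>x3\<bar> + \<bar>x4\<bar> + \<bar>x5\<bar> \<le> int (length hs)"
      "sum_list hs = g1 * x1 + g2 * x2 + g3 * x3 + g4 * x4 + g5 * x5" by auto
  obtain e :: int and g where e: "h = e * g" "\<bar>e\<bar> = 1" "g \<in> {g1, g2, g3, g4, g5}"
  proof -
    have "h \<in> {g1, g2, g3, g4, g5} \<or> - h \<in> {g1, g2, g3, g4, g5}" using Cons.prems by simp
    then show thesis using that[of 1 h] that[of "-1" "-h"] by fastforce
  qed
  have t: "\<bar>y + e\<bar> \<le> \<bar>y\<bar> + 1" for y using e(2) by linarith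
  have L: "int (length (h # hs)) = int (length hs) + 1" by simp
  from e(3) consider "g = g1" | "g = g2" | "g = g3" | "g = g4" | "g = g5" by blast
  then show ?case
  proof cases
    case 1
    show ?thesis unfolding L
      by (rule exI[of _ "x1 + e"], rule exI[of _ x2], rule exI[of _ x3], rule exI[of _ x4], rule exI[of _ x5])
        (use x e 1 t[of x1] in \<open>auto simp: algebra_simps\<close>)
  next
    case 2
    show ?thesis unfolding L
      by (rule exI[of _ x1], rule exI[of _ "x2 + e"], rule exI[of _ x3], rule exI[of _ x4], rule exI[of _ x5])
        (use x e 2 t[of x2] in \<open>auto simp: algebra_simps\<close>)
  next
    case 3
    show ?thesis unfolding L
      by (rule exI[of _ x1], rule exI[of _ x2], rule exI[of _ "x3 + e"], rule exI[of _ x4], rule exI[of _ x5])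
        (use x e 3 t[of x3] in \<open>auto simp: algebra_simps\<close>)
  next
    case 4
    show ?thesis unfolding L
      by (rule exI[of _ x1], rule exI[of _ x2], rule exI[of _ x3], rule exI[of _ "x4 + e"], rule exI[of _ x5])
        (use x e 4 t[of x4] in \<open>auto simp: algebra_simps\<close>)
  next
    case 5
    show ?thesis unfolding L
      by (rule exI[of _ x1], rule exI[of _ x2], rule exI[of _ x3], rule exI[of _ x4], rule exI[of _ "x5 + e"])
        (use x e 5 t[of x5] in \<open>auto simp: algebra_simps\<close>)
  qed
qed

subsection \<open>The lattice of relations between the generators\<close>

text \<open>The order \<open>n\<close> and the generators \<open>g\<^sub>2, \<dots>, g\<^sub>5\<close> as polynomials in \<open>m\<close>, for \<open>k = 15 m + 2\<close>.\<close>

definition circ_order :: "int \<Rightarrow> int" where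
  "circ_order m = 45 + 942 * m + 8352 * m^2 + 39744 * m^3 + 103680 * m^4 + 124416 * m^5"

definition gen2 :: "int \<Rightarrow> int" where
  "gen2 m = 19 + 312 * m + 2088 * m^2 + 6912 * m^3 + 10368 * m^4"

definition gen3 :: "int \<Rightarrow> int" where
  "gen3 m = 3 + 156 * m + 1896 * m^2 + 10656 * m^3 + 31104 * m^4 + 41472 * m^5"

definition gen4 :: "int \<Rightarrow> int" where
  "gen4 m = 5 + 168 * m + 1896 * m^2 + 10656 * m^3 + 31104 * m^4 + 41472 * m^5"

definition gen5 :: "int \<Rightarrow> int" where
  "gen5 m = 12 + 258 * m + 2328 * m^2 + 11520 * m^3 + 31104 * m^4 + 41472 * m^5"

lemmas gen_defs = circ_order_def gen2_def gen3_def gen4_def gen5_def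

definition weight :: "int \<Rightarrow> int \<Rightarrow> int \<Rightarrow> int \<Rightarrow> int \<Rightarrow> int \<Rightarrow> int" where
  "weight m x1 x2 x3 x4 x5 = x1 + gen2 m * x2 + gen3 m * x3 + gen4 m * x4 + gen5 m * x5"

text \<open>Here \<open>y\<close> is \<open>x\<close> plus the combination of the
  \<open>u\<^sub>i\<close> and \<open>v\<close> with coefficients \<open>c\<^sub>i\<close> and
  \<open>e\<close>. The weights of \<open>u\<^sub>1, ..., u\<^sub>5, v\<close> are
  \<open>0, 1, 4*m, 4*m+1, 4*m, 6*m+1\<close> times the order.\<close>

lemma cong_weight_lattice:
  assumes "a = 6 * m + 1"
    and "y1 = x1 + 2*a*c1 - c3 + c4 + a*e" "y2 = x2 + 2*a*c2 + c4 - c5 + a*e"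
    "y3 = x3 + c1 + 2*a*c3 + c4 + (a+1)*e" "y4 = x4 + 2*a*c4 - c1 - c2 - c3 - c5 + (a-2)*e"
    "y5 = x5 + c2 + c4 + 2*a*c5 + (a+1)*e"
  shows "[weight m y1 y2 y3 y4 y5 = weight m x1 x2 x3 x4 x5] (mod circ_order m)"
proof -
  have "weight m y1 y2 y3 y4 y5 = weight m x1 x2 x3 x4 x5 +
      circ_order m * (c2 + 4*m*c3 + (4*m+1)*c4 + 4*m*c5 + (6*m+1)*e)"
    unfolding weight_def gen_defs assms by algebra
  then show ?thesis by (simp add: cong_def)
qed

text \<open>
  The coefficients below express \<open>n e\<^sub>1\<close> and \<open>e\<^sub>i - g\<^sub>i e\<^sub>1\<close> in the basis \<open>u\<^sub>1, u\<^sub>2, u\<^sub>3, u\<^sub>4, v\<close>, and \<open>2 v = u\<^sub>1 + \<dots> + u\<^sub>5\<close>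
  makes the coefficient of \<open>v\<close> equal to 0 or 1.
\<close>

lemma lattice_of_dvd_weight:
  assumes a: "a = 6 * m + 1" and "circ_order m dvd weight m w1 w2 w3 w4 w5"
  obtains c1 c2 c3 c4 c5 e where "e = 0 \<or> e = 1"
    "w1 = 2*a*c1 - c3 + c4 + a*e" "w2 = 2*a*c2 + c4 - c5 + a*e" "w3 = c1 + 2*a*c3 + c4 + (a+1)*e"
    "w4 = 2*a*c4 - c1 - c2 - c3 - c5 + (a-2)*e" "w5 = c2 + c4 + 2*a*c5 + (a+1)*e"
proof -
  obtain q where q: "weight m w1 w2 w3 w4 w5 = circ_order m * q" using assms(2) by (rule dvdE)
  define d where "d = (-1 - 24*m - 144*m^2) * q + 12*m*w2 + (4*m + 48*m^2) * (w3 + w4)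
      + (1 + 4*m + 48*m^2) * w5"
  define h e where "h = d div 2" and "e = d mod 2"
  have d: "d = 2 * h + e" by (simp add: h_def e_def)
  have e: "e = 0 \<or> e = 1" unfolding e_def by presburger
  define s where "s = 56*m + 528*m^2 + 2016*m^3 + 3456*m^4"
  define t where "t = 24*m + 120*m^2 + 288*m^3"
  have w1: "w1 = circ_order m * q - gen2 m * w2 - gen3 m * w3 - gen4 m * w4 - gen5 m * w5"
    using q by (simp add: weight_def)
  have e': "e = d - 2 * h" using d by simp
  show thesis
  proof (rule that[OF e,
      of "(17 + 300*m + 2088*m^2 + 6912*m^3 + 10368*m^4) * q
        - (7 + 96*m + 432*m^2 + 864*m^3) * w2 - (1 + s) * w3 - (2 + s) * w4
        - (5 + 80*m + 600*m^2 + 2016*m^3 + 3456*m^4) * w5 + h"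
        "- (9 + 102*m + 432*m^2 + 864*m^3) * q + (4 + 24*m + 72*m^2) * w2
        + (1 + t) * (w3 + w4) + (2 + 6*m + t) * w5 + h"
        "(3 + 66*m + 432*m^2 + 864*m^3) * q - (1 + 24*m + 72*m^2) * w2
        - (t - 12*m) * (w3 + w4) - (1 - 6*m + t) * w5 + h"
        "- (1 + 12*m) * q + w2 + 4*m * (w3 + w4 + w5) + h" h])
  qed (unfold e' w1 a gen_defs d_def s_def t_def, algebra+)
qed

text \<open>
  Coordinate 4 interacts with all the others; its weight 5 in the induction measure keeps its range
  tight enough for the smallest case \<open>a = 7\<close>.
\<close>

lemma reduce_to_cube:
  assumes a: "a = 6 * m + 1" "a \<ge> 7"
  shows "\<exists>y1 y2 y3 y4 y5. [weight m y1 y2 y3 y4 y5 = weight m x1 x2 x3 x4 x5] (mod circ_order m) \<and>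
    \<bar>2*y1 - a\<bar> \<le> 2*a + 6 \<and> \<bar>2*y2 - a\<bar> \<le> 2*a + 6 \<and> \<bar>2*y3 - a\<bar> \<le> 2*a + 6 \<and>
    \<bar>2*y4 - a\<bar> \<le> 2*a \<and> \<bar>2*y5 - a\<bar> \<le> 2*a + 6"
proof -
  define N where "N y = \<bar>2*y - a\<bar>" for y
  have "\<exists>y1 y2 y3 y4 y5. [weight m y1 y2 y3 y4 y5 = weight m x1 x2 x3 x4 x5] (mod circ_order m) \<and>
    N y1 \<le> 2*a + 6 \<and> N y2 \<le> 2*a + 6 \<and> N y3 \<le> 2*a + 6 \<and>
    N y4 \<le> 2*a \<and> N y5 \<le> 2*a + 6"
  proof (induction "nat (N x1 + N x2 + N x3 + 5 * N x4 + N x5)"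
      arbitrary: x1 x2 x3 x4 x5 rule: less_induct)
    case less
    let ?goal = "\<exists>y1 y2 y3 y4 y5. [weight m y1 y2 y3 y4 y5 = weight m x1 x2 x3 x4 x5] (mod circ_order m) \<and>
      N y1 \<le> 2*a + 6 \<and> N y2 \<le> 2*a + 6 \<and> N y3 \<le> 2*a + 6 \<and>
      N y4 \<le> 2*a \<and> N y5 \<le> 2*a + 6"
    have step: ?goal
      if "z1 = x1 + 2*a*c1 - c3 + c4" "z2 = x2 + 2*a*c2 + c4 - c5" "z3 = x3 + c1 + 2*a*c3 + c4"
        "z4 = x4 + 2*a*c4 - c1 - c2 - c3 - c5" "z5 = x5 + c2 + c4 + 2*a*c5"
        and "N z1 + N z2 + N z3 + 5 * N z4 + N z5
          < N x1 + N x2 + N x3 + 5 * N x4 + N x5"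
      for z1 z2 z3 z4 z5 c1 c2 c3 c4 c5
    proof -
      have "[weight m z1 z2 z3 z4 z5 = weight m x1 x2 x3 x4 x5] (mod circ_order m)"
        by (rule cong_weight_lattice[OF a(1), where e = 0 and ?c1.0 = c1 and ?c2.0 = c2
              and ?c3.0 = c3 and ?c4.0 = c4 and ?c5.0 = c5])
          (use that in simp_all)
      moreover have "nat (N z1 + N z2 + N z3 + 5 * N z4 + N z5)
          < nat (N x1 + N x2 + N x3 + 5 * N x4 + N x5)"
        using that(6) by (subst nat_less_eq_zless) (auto simp: N_def)
      ultimately show ?goal using less[of z1 z2 z3 z4 z5] by (meson cong_trans)
    qed
    \<comment> \<open>Each step lowers the measure by at least 2: in coordinates 1, 2, 3, 5 it gains
      14 and loses at most 2 + 5 * 2; in coordinate 4 it gains 5 * 2 and loses at most 4 *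
      2.\<close>
    have far: "N (y - 2*a*sgn (2*y - a)) \<le> N y - 2 * d"
      if "N y \<ge> 2*a + d" "d \<le> 14" for y d
      using that a(2) by (auto simp: N_def sgn_if abs_if split: if_splits)
    have near: "N (y + e) \<le> N y + 2" if "\<bar>e\<bar> \<le> 1" for y e
      using that by (auto simp: N_def abs_if split: if_splits)
    have sg: "\<bar>sgn (2*y - a)\<bar> \<le> 1" "\<bar>- sgn (2*y - a)\<bar> \<le> 1" for y by (simp_all add: sgn_if)
    consider "N x1 > 2*a + 6" | "N x2 > 2*a + 6" | "N x3 > 2*a + 6"
      | "N x4 > 2*a" | "N x5 > 2*a + 6"
      | "N x1 \<le> 2*a + 6" "N x2 \<le> 2*a + 6" "N x3 \<le> 2*a + 6"
        "N x4 \<le> 2*a" "N x5 \<le> 2*a + 6" by linarith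
    then show ?case
    proof cases
      case 1
      let ?s = "sgn (2*x1 - a)"
      show ?thesis
        by (rule step[of "x1 - 2*a*?s" "-?s" 0 0 x2 0 0 "x3 + (-?s)" "x4 + ?s" x5])
          (use far[of 7 x1] near[OF sg(2)[of x1], of x3] near[OF sg(1)[of x1], of x4] 1 in simp_all)
    next
      case 2
      let ?s = "sgn (2*x2 - a)"
      show ?thesis
        by (rule step[of x1 0 0 0 "x2 - 2*a*?s" "-?s" 0 x3 "x4 + ?s" "x5 + (-?s)"])
          (use far[of 7 x2] near[OF sg(2)[of x2], of x5] near[OF sg(1)[of x2], of x4] 2 in simp_all)
    next
      case 3
      let ?s = "sgn (2*x3 - a)"
      show ?thesis
        by (rule step[of "x1 + ?s" 0 "-?s" 0 x2 0 0 "x3 - 2*a*?s" "x4 + ?s" x5])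
          (use far[of 7 x3] near[OF sg(1)[of x3], of x1] near[OF sg(1)[of x3], of x4] 3 in simp_all)
    next
      case 4
      let ?s = "sgn (2*x4 - a)"
      show ?thesis
        by (rule step[of "x1 + (-?s)" 0 0 "-?s" "x2 + (-?s)" 0 0 "x3 + (-?s)" "x4 - 2*a*?s" "x5 + (-?s)"])
          (use far[of 1 x4] near[OF sg(2)[of x4], of x1] near[OF sg(2)[of x4], of x2]
            near[OF sg(2)[of x4], of x3] near[OF sg(2)[of x4], of x5] 4 in simp_all)
    next
      case 5
      let ?s = "sgn (2*x5 - a)"
      show ?thesis
        by (rule step[of x1 0 0 0 "x2 + ?s" 0 "-?s" x3 "x4 + ?s" "x5 - 2*a*?s"])
          (use far[of 7 x5] near[OF sg(1)[of x5], of x2] near[OF sg(1)[of x5], of x4] 5 in simp_all)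
    next
      case 6
      then show ?thesis by (intro exI[of _ x1] exI[of _ x2] exI[of _ x3] exI[of _ x4] exI[of _ x5]) simp
    qed
  qed
  then show ?thesis unfolding N_def .
qed

subsection \<open>Covering by boxes\<close>

definition between0 :: "int \<Rightarrow> int \<Rightarrow> bool" where
  "between0 x v \<longleftrightarrow> 0 \<le> x \<and> x \<le> v \<or> v \<le> x \<and> x \<le> 0"

lemma abs_between0: "between0 x v \<Longrightarrow> \<bar>x\<bar> + \<bar>x - v\<bar> = \<bar>v\<bar>"
  by (auto simp: between0_def)

text \<open>
  \<open>f\<close> says whether the face nearest to a coordinate \<open>x\<^sub>i\<close> is the one at \<open>a\<close> rather than the one at \<open>0\<close>. The
  box chosen is spanned by the lattice points \<open>\<Sum>i. c\<^sub>i u\<^sub>i\<close> and \<open>\<Sum>i. c\<^sub>i u\<^sub>i + v\<^sub>s\<close>, where \<open>s\<^sub>i = 1 - 2 d\<^sub>i\<close>.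
\<close>

definition corner :: "bool \<Rightarrow> int \<Rightarrow> int \<Rightarrow> bool" where
  "corner f c d \<longleftrightarrow> d \<in> {0, 1} \<and> c = (if f then d else 0)"

text \<open>
  Coordinates 1, 3 (or 2, 5) can be settled whatever is chosen in coordinate 4. A coordinate depending
  on one undecided neighbour sees its face at one of two adjacent integers, so an integer
  is always on one side of both; it is decided first, and the other coordinate then follows.
\<close>

lemma triangle_corners:
  fixes a :: int
  assumes "odd a" "a \<ge> 7" "\<bar>2*x - a\<bar> \<le> 2*a + 6" "\<bar>2*y - a\<bar> \<le> 2*a + 6"
  shows "\<exists>c d c' d'. corner (2*x > a) c d \<and> corner (2*y > a) c' d' \<and>
    (\<forall>c4 d4. corner f c4 d4 \<longrightarrow>
      between0 (x - 2*a*c + c' - c4) (a - 2*a*d + d' - d4) \<and>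
      between0 (y - 2*a*c' - c - c4) (a + 1 - 2*a*d' - d - d4))"
proof -
  define X where "X = (2*x > a)"
  define Y where "Y = (2*y > a)"
  obtain b where b: "a = 2*b + 1" using \<open>odd a\<close> by (elim oddE)
  define P where "P d d' \<longleftrightarrow> (\<forall>c4 d4. corner f c4 d4 \<longrightarrow>
      between0 (x - 2*a * (if X then d else 0) + (if Y then d' else 0) - c4) (a - 2*a*d + d' - d4) \<and>
      between0 (y - 2*a * (if Y then d' else 0) - (if X then d else 0) - c4)
        (a + 1 - 2*a*d' - d - d4))" for d d'
  have pick: "\<exists>d\<in>{0,1}. \<exists>d'\<in>{0,1}. P d d'" if "P (of_bool A) (of_bool B)" for A B
    using that by (intro bexI[of _ "of_bool A"] bexI[of _ "of_bool B"]) auto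
  have "\<exists>d\<in>{0,1}. \<exists>d'\<in>{0,1}. P d d'"
  \<comment> \<open>If \<open>X\<close> and \<open>Y\<close> differ, the coordinate whose face is of
    the same kind as \<open>f\<close> is decided first, as only the other one can move its face. The
    threshold of the other then contains this choice.\<close>
  proof (cases X; cases Y; cases f)
    assume X Y f
    then show ?thesis using assms(2-)
      by (intro pick[of "x > a" "y > a + 1"])
        (auto simp: P_def between0_def corner_def X_def Y_def b)
  next
    assume X Y "\<not> f"
    then show ?thesis using assms(2-)
      by (intro pick[of "x \<ge> a" "y > a"])
        (auto simp: P_def between0_def corner_def X_def Y_def b)
  next
    assume X "\<not> Y" f
    then show ?thesis using assms(2-)
      by (intro pick[of "x > a" "y < 1 + of_bool (x > a)"])
        (auto simp: P_def between0_def corner_def X_def Y_def b)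
  next
    assume X "\<not> Y" "\<not> f"
    then show ?thesis using assms(2-)
      by (intro pick[of "x \<ge> a + of_bool (y < 1)" "y < 1"])
        (auto simp: P_def between0_def corner_def X_def Y_def b)
  next
    assume "\<not> X" Y f
    then show ?thesis using assms(2-)
      by (intro pick[of "x + of_bool (y > a) < 1" "y > a"])
        (auto simp: P_def between0_def corner_def X_def Y_def b)
  next
    assume "\<not> X" Y "\<not> f"
    then show ?thesis using assms(2-)
      by (intro pick[of "x < 0" "y > a - of_bool (x < 0)"])
        (auto simp: P_def between0_def corner_def X_def Y_def b)
  next
    assume "\<not> X" "\<not> Y" f
    then show ?thesis using assms(2-)
      by (intro pick[of "x < 1" "y < 1"])
        (auto simp: P_def between0_def corner_def X_def Y_def b)
  next
    assume "\<not> X" "\<not> Y" "\<not> f"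
    then show ?thesis using assms(2-)
      by (intro pick[of "x < 0" "y < 0"])
        (auto simp: P_def between0_def corner_def X_def Y_def b)
  qed
  then obtain d d' where dd: "d \<in> {0,1}" "d' \<in> {0,1}" and P: "P d d'" by blast
  have corners: "corner (2*x > a) (if X then d else 0) d" "corner (2*y > a) (if Y then d' else 0) d'"
    using dd by (simp_all add: corner_def X_def Y_def)
  show ?thesis by (intro exI conjI, fact+) (fact P[unfolded P_def])
qed

lemma cornerD:
  assumes "corner f c d" shows "d \<in> {0, 1} \<and> 0 \<le> c \<and> c \<le> d"
  using assms by (auto simp: corner_def)

text \<open>With all four neighbours settled, summed up in \<open>C\<close> and \<open>D\<close>,
  the face has one known position and \<open>x\<close> takes its side. The bound
  \<open>x + C \<le> 2*a\<close> is attained at \<open>a = 7\<close>, \<open>x = 10\<close>,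
  \<open>C = 4\<close>.\<close>

lemma centre_corner:
  fixes a :: int
  assumes "odd a" "a \<ge> 7" "\<bar>2*x - a\<bar> \<le> 2*a"
    "0 \<le> C" "C \<le> D" "D \<le> 4"
  shows "\<exists>c d. corner (2*x > a) c d \<and> between0 (x - 2*a*c + C) (a - 2 - 2*a*d + D)"
proof (cases "2*x > a")
  case True
  show ?thesis
  proof (cases "x + C \<le> a - 2 + D")
    case 1: True
    then show ?thesis using True assms by (intro exI[of _ 0]) (auto simp: corner_def between0_def)
  next
    case False
    then show ?thesis using True assms by (intro exI[of _ 1]) (auto simp: corner_def between0_def)
  qed
next
  case False
  show ?thesis
  proof (cases "x + C \<ge> 0")
    case True
    then show ?thesis using False assms by (intro exI[of _ 0]) (auto simp: corner_def between0_def)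
  next
    case 1: False
    then show ?thesis using False assms by (intro exI[of _ 0] exI[of _ 1]) (auto simp: corner_def between0_def)
  qed
qed

text \<open>For \<open>a \<ge> 2\<close> side \<open>i\<close> is zero or has the sign
  \<open>s\<^sub>i = 1 - 2 d\<^sub>i\<close>, so the norm is the sum of \<open>s\<^sub>i\<close>
  times side \<open>i\<close>, where the antisymmetric terms cancel in pairs.\<close>

lemma sum_abs_sides:
  fixes a :: int
  assumes "a \<ge> 2" "d1 \<in> {0,1}" "d2 \<in> {0,1}" "d3 \<in> {0,1}" "d4 \<in> {0,1}" "d5 \<in> {0,1}"
  shows "\<bar>a - 2*a*d1 + d3 - d4\<bar> + \<bar>a - 2*a*d2 + d5 - d4\<bar> + \<bar>a + 1 - 2*a*d3 - d1 - d4\<bar> +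
    \<bar>a - 2 - 2*a*d4 + (d1 + d2 + d3 + d5)\<bar> + \<bar>a + 1 - 2*a*d5 - d2 - d4\<bar> = 5 * a"
  using assms by auto

subsection \<open>A vertex at distance \<open>k\<close>\<close>

lemma abs_shift_ge:
  fixes a :: int
  assumes "0 \<le> x" "x + p \<le> a"
  shows "x + 2 * p * \<bar>c\<bar> \<le> \<bar>x - 2*a*c\<bar>"
proof (cases "c = 0")
  case False
  then have "(x + p) * \<bar>c\<bar> \<le> a * \<bar>c\<bar>" "x * 1 \<le> x * \<bar>c\<bar>"
    using assms mult_left_mono[of 1 "\<bar>c\<bar>" x] by (auto intro!: mult_right_mono)
  moreover have "\<bar>2*a*c\<bar> \<le> \<bar>x - 2*a*c\<bar> + \<bar>x\<bar>" by linarith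
  moreover have "\<bar>2*a*c\<bar> = 2 * (\<bar>a\<bar> * \<bar>c\<bar>)" by (simp add: abs_mult)
  moreover have "a * \<bar>c\<bar> \<le> \<bar>a\<bar> * \<bar>c\<bar>" by (intro mult_right_mono) auto
  ultimately show ?thesis using assms(1) by (simp add: algebra_simps)
qed (use assms in simp)

text \<open>The diagonal part gains \<open>2*\<bar>c\<^sub>i\<bar>\<close>, and
  \<open>4*\<bar>c4\<bar>\<close> in coordinate 4. This pays for the off-diagonal entries, two in
  each \<open>u\<^sub>i\<close> but four in \<open>u\<^sub>4\<close>, whence the larger margin for
  \<open>x4\<close>.\<close>

lemma norm_add_lattice_ge:
  fixes a :: int
  assumes "0 \<le> x1" "x1 < a" "0 \<le> x2" "x2 < a" "0 \<le> x3" "x3 < a" "0 \<le> x4" "x4 + 2 \<le> a" "0 \<le> x5" "x5 < a"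
  shows "x1 + x2 + x3 + x4 + x5 \<le> \<bar>x1 - (2*a*c1 - c3 + c4)\<bar> + \<bar>x2 - (2*a*c2 + c4 - c5)\<bar>
    + \<bar>x3 - (c1 + 2*a*c3 + c4)\<bar> + \<bar>x4 - (2*a*c4 - c1 - c2 - c3 - c5)\<bar> + \<bar>x5 - (c2 + c4 + 2*a*c5)\<bar>"
proof -
  have "x1 + 2*\<bar>c1\<bar> \<le> \<bar>x1 - 2*a*c1\<bar>" "x2 + 2*\<bar>c2\<bar> \<le> \<bar>x2 - 2*a*c2\<bar>"
    "x3 + 2*\<bar>c3\<bar> \<le> \<bar>x3 - 2*a*c3\<bar>" "x5 + 2*\<bar>c5\<bar> \<le> \<bar>x5 - 2*a*c5\<bar>"
    using abs_shift_ge[of _ 1 a] assms by auto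
  moreover have "x4 + 4*\<bar>c4\<bar> \<le> \<bar>x4 - 2*a*c4\<bar>" using abs_shift_ge[of x4 2 a c4] assms by auto
  moreover have "\<bar>x1 - 2*a*c1\<bar> \<le> \<bar>x1 - (2*a*c1 - c3 + c4)\<bar> + \<bar>c3\<bar> + \<bar>c4\<bar>"
    "\<bar>x2 - 2*a*c2\<bar> \<le> \<bar>x2 - (2*a*c2 + c4 - c5)\<bar> + \<bar>c4\<bar> + \<bar>c5\<bar>"
    "\<bar>x3 - 2*a*c3\<bar> \<le> \<bar>x3 - (c1 + 2*a*c3 + c4)\<bar> + \<bar>c1\<bar> + \<bar>c4\<bar>"
    "\<bar>x5 - 2*a*c5\<bar> \<le> \<bar>x5 - (c2 + c4 + 2*a*c5)\<bar> + \<bar>c2\<bar> + \<bar>c4\<bar>"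
    "\<bar>x4 - 2*a*c4\<bar> \<le> \<bar>x4 - (2*a*c4 - c1 - c2 - c3 - c5)\<bar> + \<bar>c1\<bar> + \<bar>c2\<bar> + \<bar>c3\<bar> + \<bar>c5\<bar>"
    by linarith+
  ultimately show ?thesis by linarith
qed

subsection \<open>The diameter\<close>

lemma short_vector_exists_large:
  assumes "m \<ge> 1"
  shows "\<exists>x1 x2 x3 x4 x5. [weight m x1 x2 x3 x4 x5 = r] (mod circ_order m) \<and>
    \<bar>x1\<bar> + \<bar>x2\<bar> + \<bar>x3\<bar> + \<bar>x4\<bar> + \<bar>x5\<bar> \<le> 15*m + 2"
proof -
  define a where "a = 6*m + 1"
  have a: "odd a" "a \<ge> 7" using assms by (simp_all add: a_def)
  obtain y1 y2 y3 y4 y5 where y: "[weight m y1 y2 y3 y4 y5 = weight m r 0 0 0 0] (mod circ_order m)"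
    and b: "\<bar>2*y1 - a\<bar> \<le> 2*a + 6" "\<bar>2*y2 - a\<bar> \<le> 2*a + 6" "\<bar>2*y3 - a\<bar> \<le> 2*a + 6"
      "\<bar>2*y4 - a\<bar> \<le> 2*a" "\<bar>2*y5 - a\<bar> \<le> 2*a + 6"
    using reduce_to_cube[OF a_def a(2), of r 0 0 0 0] by blast
  let ?f = "2*y4 > a"
  obtain c1 d1 c3 d3 where c13: "corner (2*y1 > a) c1 d1" "corner (2*y3 > a) c3 d3"
    and b13: "\<And>c4 d4. corner ?f c4 d4 \<Longrightarrow>
      between0 (y1 - 2*a*c1 + c3 - c4) (a - 2*a*d1 + d3 - d4) \<and>
      between0 (y3 - 2*a*c3 - c1 - c4) (a + 1 - 2*a*d3 - d1 - d4)"
    using triangle_corners[OF a b(1,3), of ?f] by blast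
  obtain c2 d2 c5 d5 where c25: "corner (2*y2 > a) c2 d2" "corner (2*y5 > a) c5 d5"
    and b25: "\<And>c4 d4. corner ?f c4 d4 \<Longrightarrow>
      between0 (y2 - 2*a*c2 + c5 - c4) (a - 2*a*d2 + d5 - d4) \<and>
      between0 (y5 - 2*a*c5 - c2 - c4) (a + 1 - 2*a*d5 - d2 - d4)"
    using triangle_corners[OF a b(2,5), of ?f] by blast
  note cb = c13[THEN cornerD] c25[THEN cornerD]
  obtain c4 d4 where c4: "corner ?f c4 d4"
    and b4: "between0 (y4 - 2*a*c4 + (c1 + c2 + c3 + c5)) (a - 2 - 2*a*d4 + (d1 + d2 + d3 + d5))"
    using centre_corner[OF a b(4), of "c1 + c2 + c3 + c5" "d1 + d2 + d3 + d5"] cb by auto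
  \<comment> \<open>\<open>?X\<close> is the position relative to the base corner of the box and
    \<open>?V\<close> is \<open>v\<^sub>s\<close>, that is, \<open>v\<close> minus the
    \<open>u\<^sub>i\<close> with \<open>d\<^sub>i = 1\<close>.\<close>
  let ?X1 = "y1 - 2*a*c1 + c3 - c4" and ?X2 = "y2 - 2*a*c2 + c5 - c4"
    and ?X3 = "y3 - 2*a*c3 - c1 - c4" and ?X4 = "y4 - 2*a*c4 + (c1 + c2 + c3 + c5)"
    and ?X5 = "y5 - 2*a*c5 - c2 - c4"
  let ?V1 = "a - 2*a*d1 + d3 - d4" and ?V2 = "a - 2*a*d2 + d5 - d4"
    and ?V3 = "a + 1 - 2*a*d3 - d1 - d4" and ?V4 = "a - 2 - 2*a*d4 + (d1 + d2 + d3 + d5)"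
    and ?V5 = "a + 1 - 2*a*d5 - d2 - d4"
  have "[weight m ?X1 ?X2 ?X3 ?X4 ?X5 = weight m y1 y2 y3 y4 y5] (mod circ_order m)"
    by (rule cong_weight_lattice[OF a_def, where e = 0 and ?c1.0 = "-c1" and ?c2.0 = "-c2"
          and ?c3.0 = "-c3" and ?c4.0 = "-c4" and ?c5.0 = "-c5"]) (simp_all add: algebra_simps)
  then have near: "[weight m ?X1 ?X2 ?X3 ?X4 ?X5 = r] (mod circ_order m)"
    using y by (auto simp: weight_def cong_def)
  have "[weight m (?X1 - ?V1) (?X2 - ?V2) (?X3 - ?V3) (?X4 - ?V4) (?X5 - ?V5) =
      weight m y1 y2 y3 y4 y5] (mod circ_order m)"
    by (rule cong_weight_lattice[OF a_def, where e = "-1" and ?c1.0 = "d1-c1" and ?c2.0 = "d2-c2"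
          and ?c3.0 = "d3-c3" and ?c4.0 = "d4-c4" and ?c5.0 = "d5-c5"]) (simp_all add: algebra_simps)
  then have far: "[weight m (?X1 - ?V1) (?X2 - ?V2) (?X3 - ?V3) (?X4 - ?V4) (?X5 - ?V5) = r]
      (mod circ_order m)"
    using y by (auto simp: weight_def cong_def)
  have "\<bar>?V1\<bar> + \<bar>?V2\<bar> + \<bar>?V3\<bar> + \<bar>?V4\<bar> + \<bar>?V5\<bar> = 5 * a"
    using a(2) cb cornerD[OF c4] by (intro sum_abs_sides) auto
  then have "(\<bar>?X1\<bar> + \<bar>?X2\<bar> + \<bar>?X3\<bar> + \<bar>?X4\<bar> + \<bar>?X5\<bar>) +
      (\<bar>?X1 - ?V1\<bar> + \<bar>?X2 - ?V2\<bar> + \<bar>?X3 - ?V3\<bar> + \<bar>?X4 - ?V4\<bar> + \<bar>?X5 - ?V5\<bar>) = 5 * a"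
    unfolding b13[OF c4, THEN conjunct1, THEN abs_between0, symmetric]
      b13[OF c4, THEN conjunct2, THEN abs_between0, symmetric]
      b25[OF c4, THEN conjunct1, THEN abs_between0, symmetric]
      b25[OF c4, THEN conjunct2, THEN abs_between0, symmetric]
      b4[THEN abs_between0, symmetric] by (simp only: ac_simps)
  then have "\<bar>?X1\<bar> + \<bar>?X2\<bar> + \<bar>?X3\<bar> + \<bar>?X4\<bar> + \<bar>?X5\<bar> \<le> 15*m + 2 \<or>
      \<bar>?X1 - ?V1\<bar> + \<bar>?X2 - ?V2\<bar> + \<bar>?X3 - ?V3\<bar> + \<bar>?X4 - ?V4\<bar> + \<bar>?X5 - ?V5\<bar> \<le> 15*m + 2"
    (is "?S \<le> _ \<or> ?T \<le> _")
  proof -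
    have "S + T = 5 * a \<Longrightarrow> S \<le> 15*m + 2 \<or> T \<le> 15*m + 2" for S T
      unfolding a_def by presburger
    then show "?S + ?T = 5 * a \<Longrightarrow> ?S \<le> 15*m + 2 \<or> ?T \<le> 15*m + 2" .
  qed
  then show ?thesis using near far by blast
qed

lemma short_vector_exists_0:
  "\<exists>x1 x2 x3 x4 x5. [weight 0 x1 x2 x3 x4 x5 = r] (mod circ_order 0) \<and>
    \<bar>x1\<bar> + \<bar>x2\<bar> + \<bar>x3\<bar> + \<bar>x4\<bar> + \<bar>x5\<bar> \<le> 2"
proof -
  \<comment> \<open>The entries represent the residues 0, ..., 44 in this order, for the generators
    1, 19, 3, 5, 12.\<close>
  define W :: "(int \<times> int \<times> int \<times> int \<times> int) list" where "W = [
    (0,0,0,0,0), (1,0,0,0,0), (2,0,0,0,0), (0,0,1,0,0), (1,0,1,0,0), (0,0,0,1,0),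
    (0,0,2,0,0), (0,-2,0,0,0), (0,0,1,1,0), (0,0,-1,0,1), (0,0,0,2,0), (-1,0,0,0,1),
    (0,0,0,0,1), (1,0,0,0,1), (0,1,0,-1,0), (0,0,1,0,1), (0,1,-1,0,0), (0,0,0,1,1),
    (-1,1,0,0,0), (0,1,0,0,0), (1,1,0,0,0), (0,0,0,0,-2), (0,1,1,0,0), (0,-1,-1,0,0),
    (0,0,0,0,2), (-1,-1,0,0,0), (0,-1,0,0,0), (1,-1,0,0,0), (0,0,0,-1,-1), (0,-1,1,0,0),
    (0,0,-1,0,-1), (0,1,0,0,1), (-1,0,0,0,-1), (0,0,0,0,-1), (1,0,0,0,-1), (0,0,0,-2,0),
    (0,0,1,0,-1), (0,0,-1,-1,0), (0,2,0,0,0), (0,0,-2,0,0), (0,0,0,-1,0), (1,0,0,-1,0),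
    (0,0,-1,0,0), (-2,0,0,0,0), (-1,0,0,0,0)]"
  have "map (\<lambda>(x1, x2, x3, x4, x5). weight 0 x1 x2 x3 x4 x5 mod 45) W = [0..44]"
    by (simp add: W_def weight_def gen_defs upto_rec1)
  then have "set [0..44] = (\<lambda>(x1, x2, x3, x4, x5). weight 0 x1 x2 x3 x4 x5 mod 45) ` set W"
    by (metis list.set_map)
  moreover have "r mod 45 \<in> set [0..44]" by simp
  ultimately have "r mod 45 \<in> (\<lambda>(x1, x2, x3, x4, x5). weight 0 x1 x2 x3 x4 x5 mod 45) ` set W"
    by simp
  then obtain x1 x2 x3 x4 x5 where x: "(x1, x2, x3, x4, x5) \<in> set W"
    "weight 0 x1 x2 x3 x4 x5 mod 45 = r mod 45" by force
  have "\<forall>(x1, x2, x3, x4, x5) \<in> set W. \<bar>x1\<bar> + \<bar>x2\<bar> + \<bar>x3\<bar> + \<bar>x4\<bar> + \<bar>x5\<bar> \<le> 2"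
    by (simp add: W_def)
  then have "\<bar>x1\<bar> + \<bar>x2\<bar> + \<bar>x3\<bar> + \<bar>x4\<bar> + \<bar>x5\<bar> \<le> 2" using x(1) by blast
  moreover have "[weight 0 x1 x2 x3 x4 x5 = r] (mod circ_order 0)"
    using x(2) by (simp add: cong_def circ_order_def)
  ultimately show ?thesis by blast
qed

lemma short_vector_exists:
  assumes "m \<ge> 0"
  shows "\<exists>x1 x2 x3 x4 x5. [weight m x1 x2 x3 x4 x5 = r] (mod circ_order m) \<and>
    \<bar>x1\<bar> + \<bar>x2\<bar> + \<bar>x3\<bar> + \<bar>x4\<bar> + \<bar>x5\<bar> \<le> 15*m + 2"
proof (cases "m = 0")
  case True
  then show ?thesis using short_vector_exists_0[of r] by simp
next
  case False
  then show ?thesis using assms by (intro short_vector_exists_large) simp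
qed

lemma deep_hole_large:
  assumes m: "m \<ge> 1"
    and "[weight m z1 z2 z3 z4 z5 = weight m (3*m) (3*m) (3*m+1) (3*m) (3*m+1)] (mod circ_order m)"
  shows "15*m + 2 \<le> \<bar>z1\<bar> + \<bar>z2\<bar> + \<bar>z3\<bar> + \<bar>z4\<bar> + \<bar>z5\<bar>"
proof -
  define a where "a = 6*m + 1"
  have "circ_order m dvd
      weight m (3*m) (3*m) (3*m+1) (3*m) (3*m+1) - weight m z1 z2 z3 z4 z5"
    using assms(2) by (simp add: cong_iff_dvd_diff dvd_diff_commute)
  also have "\<dots> = weight m (3*m - z1) (3*m - z2) (3*m+1 - z3) (3*m - z4) (3*m+1 - z5)"
    by (simp add: weight_def algebra_simps)
  finally obtain c1 c2 c3 c4 c5 e where e: "e = 0 \<or> e = 1"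
    and w: "3*m - z1 = 2*a*c1 - c3 + c4 + a*e" "3*m - z2 = 2*a*c2 + c4 - c5 + a*e"
    "3*m+1 - z3 = c1 + 2*a*c3 + c4 + (a+1)*e"
    "3*m - z4 = 2*a*c4 - c1 - c2 - c3 - c5 + (a-2)*e" "3*m+1 - z5 = c2 + c4 + 2*a*c5 + (a+1)*e"
    by (rule lattice_of_dvd_weight[OF a_def])
  from e show ?thesis
  proof
    assume e: "e = 0"
    have z: "z1 = 3*m - (2*a*c1 - c3 + c4)" "z2 = 3*m - (2*a*c2 + c4 - c5)"
      "z3 = 3*m+1 - (c1 + 2*a*c3 + c4)" "z4 = 3*m - (2*a*c4 - c1 - c2 - c3 - c5)"
      "z5 = 3*m+1 - (c2 + c4 + 2*a*c5)"
      using w e by simp_all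
    show ?thesis
      using norm_add_lattice_ge[of "3*m" a "3*m" "3*m+1" "3*m" "3*m+1" c1 c3 c4 c2 c5] m
      unfolding z a_def by simp
  next
    assume e: "e = 1"
    \<comment> \<open>Reflecting in \<open>v / 2\<close> moves the hole to \<open>v\<close> minus
      the hole, of norm \<open>15*m + 3\<close>, and leaves a combination of the
      \<open>u\<^sub>i\<close> alone.\<close>
    have z: "- z1 = 3*m+1 - (2*a*(-c1) - (-c3) + (-c4))" "- z2 = 3*m+1 - (2*a*(-c2) + (-c4) - (-c5))"
      "- z3 = 3*m+1 - ((-c1) + 2*a*(-c3) + (-c4))"
      "- z4 = 3*m-1 - (2*a*(-c4) - (-c1) - (-c2) - (-c3) - (-c5))"
      "- z5 = 3*m+1 - ((-c2) + (-c4) + 2*a*(-c5))"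
      using w e by (simp_all add: a_def)
    have "3*m+1 + (3*m+1) + (3*m+1) + (3*m-1) + (3*m+1) \<le>
        \<bar>- z1\<bar> + \<bar>- z2\<bar> + \<bar>- z3\<bar> + \<bar>- z4\<bar> + \<bar>- z5\<bar>"
      unfolding z by (rule norm_add_lattice_ge) (use m in \<open>simp_all add: a_def\<close>)
    then show ?thesis unfolding abs_minus_cancel by linarith
  qed
qed

lemma deep_hole_0:
  assumes "[weight 0 z1 z2 z3 z4 z5 = 2] (mod circ_order 0)"
  shows "2 \<le> \<bar>z1\<bar> + \<bar>z2\<bar> + \<bar>z3\<bar> + \<bar>z4\<bar> + \<bar>z5\<bar>"
proof (rule ccontr)
  assume "\<not> 2 \<le> \<bar>z1\<bar> + \<bar>z2\<bar> + \<bar>z3\<bar> + \<bar>z4\<bar> + \<bar>z5\<bar>"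
  then have "(z1, z2, z3, z4, z5) \<in> {(0,0,0,0,0), (1,0,0,0,0), (-1,0,0,0,0), (0,1,0,0,0), (0,-1,0,0,0),
      (0,0,1,0,0), (0,0,-1,0,0), (0,0,0,1,0), (0,0,0,-1,0), (0,0,0,0,1), (0,0,0,0,-1)}"
    by simp presburger
  then show False using assms by (auto simp: weight_def gen_defs cong_def)
qed

lemma deep_hole_exists:
  assumes "m \<ge> 0"
  shows "\<exists>r. \<forall>z1 z2 z3 z4 z5. [weight m z1 z2 z3 z4 z5 = r] (mod circ_order m) \<longrightarrow>
    15*m + 2 \<le> \<bar>z1\<bar> + \<bar>z2\<bar> + \<bar>z3\<bar> + \<bar>z4\<bar> + \<bar>z5\<bar>"
proof (cases "m = 0")
  case True
  then show ?thesis using deep_hole_0 by (intro exI[of _ 2]) auto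
next
  case False
  then show ?thesis using assms deep_hole_large[of m] by fastforce
qed

section \<open>From lattice distances to the graph\<close>

lemma circ_order_pos: "m \<ge> 0 \<Longrightarrow> circ_order m > 0"
  by (simp add: circ_order_def add_pos_nonneg)

lemma graph_diameter_circulant_gens:
  fixes m :: nat
  shows "graph_diameter (with_proj (circulant_graph (nat (circ_order (int m)))
    {1, gen2 (int m), gen3 (int m), gen4 (int m), gen5 (int m)})) = enat (15*m + 2)"
proof -
  let ?m = "int m"
  let ?S = "{1, gen2 ?m, gen3 ?m, gen4 ?m, gen5 ?m}"
  have n: "int (nat (circ_order ?m)) = circ_order ?m" using circ_order_pos[of ?m] by simp
  obtain r0 where r0: "\<And>z1 z2 z3 z4 z5. [weight ?m z1 z2 z3 z4 z5 = r0] (mod circ_order ?m) \<Longrightarrow>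
    15*?m + 2 \<le> \<bar>z1\<bar> + \<bar>z2\<bar> + \<bar>z3\<bar> + \<bar>z4\<bar> + \<bar>z5\<bar>"
    using deep_hole_exists[of ?m] by auto
  show ?thesis
  proof (rule graph_diameter_circulant_eqI)
    show "nat (circ_order ?m) > 0" using circ_order_pos[of ?m] by simp
  next
    fix r
    obtain x1 x2 x3 x4 x5 where x: "[weight ?m x1 x2 x3 x4 x5 = r] (mod circ_order ?m)"
      "\<bar>x1\<bar> + \<bar>x2\<bar> + \<bar>x3\<bar> + \<bar>x4\<bar> + \<bar>x5\<bar> \<le> 15*?m + 2"
      using short_vector_exists[of ?m r] by auto
    obtain hs where hs: "int (length hs) = \<bar>x1\<bar> + \<bar>x2\<bar> + \<bar>x3\<bar> + \<bar>x4\<bar> + \<bar>x5\<bar>"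
      "\<forall>h\<in>set hs. h \<in> ?S \<or> - h \<in> ?S" "sum_list hs = weight ?m x1 x2 x3 x4 x5"
      using word_of_vector[of x1 x2 x3 x4 x5 1 "gen2 ?m" "gen3 ?m" "gen4 ?m" "gen5 ?m"]
      unfolding weight_def mult_1 by blast
    have "length hs \<le> 15*m + 2" using hs(1) x(2) by linarith
    then show "\<exists>hs. length hs \<le> 15*m + 2 \<and> (\<forall>h\<in>set hs. h \<in> ?S \<or> - h \<in> ?S) \<and>
        [sum_list hs = r] (mod int (nat (circ_order ?m)))"
      using hs(2,3) x(1) n by auto
  next
    fix hs
    assume hs: "\<forall>h\<in>set hs. h \<in> ?S \<or> - h \<in> ?S" "[sum_list hs = r0] (mod int (nat (circ_order ?m)))"
    obtain x1 x2 x3 x4 x5 where "\<bar>x1\<bar> + \<bar>x2\<bar> + \<bar>x3\<bar> + \<bar>x4\<bar> + \<bar>x5\<bar> \<le> int (length hs)"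
      "sum_list hs = weight ?m x1 x2 x3 x4 x5"
      using vector_of_word[OF hs(1)] unfolding weight_def mult_1 by blast
    then show "15*m + 2 \<le> length hs" using r0[of x1 x2 x3 x4 x5] hs(2) n by simp
  qed
qed

text \<open>For \<open>m \<ge> 1\<close> the generators increase and stay below the order; at
  \<open>m = 0\<close> the second, 19, is the largest.\<close>

lemma card_gens:
  fixes m :: nat
  shows "card ((\<lambda>g. g mod circ_order (int m)) ` {1, gen2 (int m), gen3 (int m), gen4 (int m), gen5 (int m)}) = 5"
proof (cases m)
  case 0
  then show ?thesis by (simp add: gen_defs)
next
  case (Suc t)
  have "1 < gen2 (int m)" "gen2 (int m) < gen3 (int m)" "gen3 (int m) < gen4 (int m)"
    "gen4 (int m) < gen5 (int m)" "gen5 (int m) < circ_order (int m)"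
    unfolding Suc gen_defs by (simp_all add: algebra_simps eval_nat_numeral add_pos_nonneg)
  then show ?thesis by simp
qed

theorem theorem5:
  fixes k :: nat
  assumes "k > 0" and "[k = 2] (mod 15)"
  shows "\<exists>(n::nat) (g2::int) (g3::int) (g4::int) (g5::int).
    real n = (512 * real k ^ 5 + 1280 * real k ^ 4 + 6080 * real k ^ 3 + 7840 * real k ^ 2
                + 10010 * real k + 3741) / 3125 \<and>
    real_of_int g2 = (128 * real k ^ 4 + 256 * real k ^ 3 + 1192 * real k ^ 2
                + 1064 * real k + 883) / 625 \<and>
    real_of_int g3 = (512 * real k ^ 5 + 640 * real k ^ 4 + 4000 * real k ^ 3 - 1320 * real k ^ 2
                - 6660 * real k - 11899) / 9375 \<and>
    real_of_int g4 = (512 * real k ^ 5 + 640 * real k ^ 4 + 4000 * real k ^ 3 - 1320 * real k ^ 2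
                + 840 * real k - 8149) / 9375 \<and>
    real_of_int g5 = (512 * real k ^ 5 + 640 * real k ^ 4 + 6400 * real k ^ 3 + 2280 * real k ^ 2
                + 13890 * real k - 2224) / 9375 \<and>
    (\<exists>S. S \<subseteq> {0..<int n} \<and> card S = 5 \<and>
         graph_diameter (with_proj (circulant_graph n S)) = enat k) \<and>
    card ((\<lambda>g. g mod int n) ` {1, g2, g3, g4, g5}) = 5 \<and>
    graph_diameter (with_proj (circulant_graph n {1, g2, g3, g4, g5})) = enat k"
proof -
  have "k mod 15 = 2" using assms(2) by (simp add: cong_def)
  then obtain m where k: "k = 15*m + 2" by (metis mult_div_mod_eq)
  define n where "n = nat (circ_order (int m))"
  have n: "int n = circ_order (int m)" using circ_order_pos[of "int m"] by (simp add: n_def)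
  let ?G = "{1, gen2 (int m), gen3 (int m), gen4 (int m), gen5 (int m)}"
  have rk: "real k = 15 * real m + 2" by (simp add: k)
  have rn: "real n = real_of_int (circ_order (int m))" using n by (metis of_int_of_nat_eq)
  have card: "card ((\<lambda>g. g mod int n) ` ?G) = 5" unfolding n by (rule card_gens)
  have diam: "graph_diameter (with_proj (circulant_graph n ?G)) = enat k"
    unfolding n_def k by (rule graph_diameter_circulant_gens)
  have "(\<lambda>g. g mod int n) ` ?G \<subseteq> {0..<int n}"
    using n circ_order_pos[of "int m"] by auto
  moreover have "graph_diameter (with_proj (circulant_graph n ((\<lambda>g. g mod int n) ` ?G))) = enat k"
    unfolding circulant_graph_mod by (rule diam)
  ultimately have S: "\<exists>S. S \<subseteq> {0..<int n} \<and> card S = 5 \<and>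
         graph_diameter (with_proj (circulant_graph n S)) = enat k"
    using card by blast
  show ?thesis
  proof (rule exI[of _ n], rule exI[of _ "gen2 (int m)"], rule exI[of _ "gen3 (int m)"],
      rule exI[of _ "gen4 (int m)"], rule exI[of _ "gen5 (int m)"], intro conjI)
    show "real n = (512 * real k ^ 5 + 1280 * real k ^ 4 + 6080 * real k ^ 3 + 7840 * real k ^ 2
        + 10010 * real k + 3741) / 3125"
      unfolding rn rk circ_order_def by (simp add: field_simps) algebra
    show "real_of_int (gen2 (int m)) = (128 * real k ^ 4 + 256 * real k ^ 3 + 1192 * real k ^ 2
        + 1064 * real k + 883) / 625"
      unfolding rk gen2_def by (simp add: field_simps) algebra
    show "real_of_int (gen3 (int m)) = (512 * real k ^ 5 + 640 * real k ^ 4 + 4000 * real k ^ 3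
        - 1320 * real k ^ 2 - 6660 * real k - 11899) / 9375"
      unfolding rk gen3_def by (simp add: field_simps) algebra
    show "real_of_int (gen4 (int m)) = (512 * real k ^ 5 + 640 * real k ^ 4 + 4000 * real k ^ 3
        - 1320 * real k ^ 2 + 840 * real k - 8149) / 9375"
      unfolding rk gen4_def by (simp add: field_simps) algebra
    show "real_of_int (gen5 (int m)) = (512 * real k ^ 5 + 640 * real k ^ 4 + 6400 * real k ^ 3
        + 2280 * real k ^ 2 + 13890 * real k - 2224) / 9375"
      unfolding rk gen5_def by (simp add: field_simps) algebra
  qed (fact S card diam)+
qed

end
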